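(* Let $p_{VK}(z_1,z_2,z_3)=z_1^2+z_2^2+z_3^2-2z_1z_2-2z_2z_3-2z_3z_1$. For a nonzero complex symmetric $3\times3$ matrix $A=(a_{jk})$ put $p_A(z_1,z_2,z_3)=\sum_{j,k=1}^3a_{jk}z_jz_k$ and $$\rho(p_A)=\frac{\sup_{\boldsymbol T\in\boldsymbol\delta_3}\|p_A(\boldsymbol T)\|}{\|p_A\|_{\mathbb{D}^3,\infty}}.$$ Then: (i) for every symmetric $3\times3$ matrix $A$ all of whose entries belong to $\{1,-1\}$, $\rho(p_A)\leq\rho(p_{VK})$; (ii) for every $\alpha\in\mathbb{R}$, with $\mathscr{B}_\alpha=\begin{pmatrix}1&1&1\\1&1&\alpha\\1&\alpha&1\end{pmatrix}$, $\rho(p_{\mathscr{B}_\alpha})\leq\rho(p_{VK})$.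
   Context: $\|p\|_{\mathbb{D}^3,\infty}$ denotes the supremum of $|p|$ over the unit polydisc $\mathbb{D}^3\subset\mathbb{C}^3$. Let $\mathbb{H}=\ell^2$ be the complex Hilbert space of square-summable sequences and $\ell^2_{\mathbb{R}}\subset\ell^2$ the set of real sequences in it. For $x=(x_i)\in\mathbb{H}$, let $x^{\sharp}:\mathbb{H}\to\mathbb{C}$ be the linear functional $x^\sharp(y)=\sum_i x_iy_i$ (no conjugation). The Varopoulos operator $T_x$ on $\mathbb{C}\oplus\mathbb{H}\oplus\mathbb{C}$ is $T_x(a,h,b)=(x^\sharp(h),\,b\,x,\,0)$. Any two such operators $T_x$, $T_{x'}$ commute. Define $$\boldsymbol\delta_3=\{(T_{x_1},T_{x_2},T_{x_3}): x_j\in\ell^2_{\mathbb{R}},\ \|x_j\|\leq1,\ j=1,2,3\}.$$ *)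

theory Defs
  imports "HOL-Analysis.Analysis" "HOL-Library.Poly_Mapping"
begin

section \<open>Complex normed spaces\<close>

class complex_normed_vector = real_normed_vector +
  fixes scaleC :: "complex \<Rightarrow> 'a \<Rightarrow> 'a" (infixr "*\<^sub>C" 75)
  assumes scaleC_add_right: "c *\<^sub>C (x + y) = c *\<^sub>C x + c *\<^sub>C y"
    and scaleC_add_left: "(c + d) *\<^sub>C x = c *\<^sub>C x + d *\<^sub>C x"
    and scaleC_scaleC: "c *\<^sub>C d *\<^sub>C x = (c * d) *\<^sub>C x"
    and scaleC_one: "1 *\<^sub>C x = x"
    and scaleC_of_real: "complex_of_real r *\<^sub>C x = r *\<^sub>R x"
    and norm_scaleC: "norm (c *\<^sub>C x) = cmod c * norm x"

instantiation complex :: complex_normed_vector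
begin

definition scaleC_complex :: "complex \<Rightarrow> complex \<Rightarrow> complex"
  where "c *\<^sub>C z = c * (z :: complex)"

instance
  by standard (simp_all add: scaleC_complex_def algebra_simps norm_mult scaleR_conv_of_real)

end

text \<open>The library norm on products is the Euclidean one, so products are Hilbert direct sums.\<close>

instantiation prod :: (complex_normed_vector, complex_normed_vector) complex_normed_vector
begin

definition scaleC_prod :: "complex \<Rightarrow> 'a \<times> 'b \<Rightarrow> 'a \<times> 'b"
  where "c *\<^sub>C v = (c *\<^sub>C fst v, c *\<^sub>C snd v)"

instance
proof
  fix c d :: complex and r :: real and x y :: "'a \<times> 'b"
  show "norm (c *\<^sub>C x) = cmod c * norm x"
    by (simp add: scaleC_prod_def norm_prod_def norm_scaleC power_mult_distrib real_sqrt_mult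
        flip: distrib_left)
qed (simp_all add: scaleC_prod_def scaleC_add_right scaleC_add_left scaleC_scaleC scaleC_one
      scaleC_of_real prod_eq_iff)

end

section \<open>The Hilbert space of square-summable sequences\<close>

lemma summable_square_add:
  fixes f g :: "nat \<Rightarrow> complex"
  assumes "summable (\<lambda>n. (cmod (f n))\<^sup>2)" "summable (\<lambda>n. (cmod (g n))\<^sup>2)"
  shows "summable (\<lambda>n. (cmod (f n + g n))\<^sup>2)"
proof (rule summable_comparison_test')
  show "summable (\<lambda>n. 2 * (cmod (f n))\<^sup>2 + 2 * (cmod (g n))\<^sup>2)"
    using assms by (intro summable_add summable_mult)
  fix n
  have "(cmod (f n + g n))\<^sup>2 \<le> (cmod (f n) + cmod (g n))\<^sup>2"
    by (intro power_mono norm_triangle_ineq norm_ge_zero)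
  also have "\<dots> \<le> 2 * (cmod (f n))\<^sup>2 + 2 * (cmod (g n))\<^sup>2"
    using sum_squares_bound[of "cmod (f n)" "cmod (g n)"] by (simp add: power2_sum)
  finally show "norm ((cmod (f n + g n))\<^sup>2) \<le> 2 * (cmod (f n))\<^sup>2 + 2 * (cmod (g n))\<^sup>2"
    by simp
qed

typedef ell2 = "{f :: nat \<Rightarrow> complex. summable (\<lambda>n. (cmod (f n))\<^sup>2)}"
  morphisms coord Abs_ell2
  by (rule exI[of _ "\<lambda>_. 0"]) simp

setup_lifting type_definition_ell2

lemma summable_coord: "summable (\<lambda>n. (cmod (coord x n))\<^sup>2)"
  using coord by blast

lemma ell2_eqI: "(\<And>n. coord x n = coord y n) \<Longrightarrow> x = y"
  by (simp add: coord_inject[symmetric] fun_eq_iff)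

instantiation ell2 :: ab_group_add
begin

lift_definition zero_ell2 :: ell2 is "\<lambda>_. 0" by simp

lift_definition plus_ell2 :: "ell2 \<Rightarrow> ell2 \<Rightarrow> ell2" is "\<lambda>f g n. f n + g n"
  by (rule summable_square_add)

lift_definition uminus_ell2 :: "ell2 \<Rightarrow> ell2" is "\<lambda>f n. - f n" by simp

lift_definition minus_ell2 :: "ell2 \<Rightarrow> ell2 \<Rightarrow> ell2" is "\<lambda>f g n. f n - g n"
  subgoal for f g using summable_square_add[of f "\<lambda>n. - g n"] by simp
  done

instance by standard (transfer; simp add: algebra_simps)+

end

instantiation ell2 :: complex_normed_vector
begin

lift_definition scaleC_ell2 :: "complex \<Rightarrow> ell2 \<Rightarrow> ell2" is "\<lambda>c f n. c * f n"
  by (simp add: norm_mult power_mult_distrib summable_mult)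

definition scaleR_ell2 :: "real \<Rightarrow> ell2 \<Rightarrow> ell2"
  where "r *\<^sub>R x = complex_of_real r *\<^sub>C (x :: ell2)"

definition norm_ell2 :: "ell2 \<Rightarrow> real"
  where "norm x = sqrt (suminf (\<lambda>n. (cmod (coord x n))\<^sup>2))"

definition sgn_ell2 :: "ell2 \<Rightarrow> ell2"
  where "sgn x = inverse (norm x) *\<^sub>R (x :: ell2)"

definition dist_ell2 :: "ell2 \<Rightarrow> ell2 \<Rightarrow> real"
  where "dist x y = norm (x - y :: ell2)"

definition uniformity_ell2 :: "(ell2 \<times> ell2) filter"
  where "uniformity_ell2 = (INF e\<in>{0 <..}. principal {(x, y). dist x y < e})"

definition open_ell2 :: "ell2 set \<Rightarrow> bool"
  where "open_ell2 U \<longleftrightarrow> (\<forall>x\<in>U. eventually (\<lambda>(x', y). x' = x \<longrightarrow> y \<in> U) uniformity)"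

instance
proof
  fix a b r :: real and c d :: complex and x y :: ell2
  show cadd: "c *\<^sub>C (x + y) = c *\<^sub>C x + c *\<^sub>C y" for c :: complex and x y :: ell2
    by transfer (simp add: algebra_simps)
  show cadd': "(c + d) *\<^sub>C x = c *\<^sub>C x + d *\<^sub>C x" for c d :: complex and x :: ell2
    by transfer (simp add: algebra_simps)
  show cc: "c *\<^sub>C d *\<^sub>C x = (c * d) *\<^sub>C x" for c d :: complex and x :: ell2
    by transfer (simp add: algebra_simps)
  show c1: "1 *\<^sub>C x = x" for x :: ell2
    by transfer simp
  show "complex_of_real r *\<^sub>C x = r *\<^sub>R x"
    by (simp add: scaleR_ell2_def)
  show "a *\<^sub>R (x + y) = a *\<^sub>R x + a *\<^sub>R y" "(a + b) *\<^sub>R x = a *\<^sub>R x + b *\<^sub>R x"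
    "a *\<^sub>R b *\<^sub>R x = (a * b) *\<^sub>R x" "1 *\<^sub>R x = x"
    by (simp_all add: scaleR_ell2_def cadd cadd' cc c1)
  show nC: "norm (c *\<^sub>C x) = cmod c * norm x" for c :: complex and x :: ell2
    using suminf_mult[OF summable_coord[of x], of "(cmod c)\<^sup>2"]
    by (simp add: norm_ell2_def scaleC_ell2.rep_eq norm_mult power_mult_distrib real_sqrt_mult)
  show "norm (a *\<^sub>R x) = \<bar>a\<bar> * norm x"
    by (simp add: scaleR_ell2_def nC)
  show "dist x y = norm (x - y)" by (simp add: dist_ell2_def)
  show "sgn x = inverse (norm x) *\<^sub>R x" by (simp add: sgn_ell2_def)
  show "uniformity = (INF e\<in>{0 <..}. principal {(x, y :: ell2). dist x y < e})"
    by (simp add: uniformity_ell2_def)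
  show "open U \<longleftrightarrow> (\<forall>x\<in>U. eventually (\<lambda>(x', y). x' = x \<longrightarrow> y \<in> U) uniformity)"
    for U :: "ell2 set" by (simp add: open_ell2_def)
  have "(norm x = 0) = (\<forall>n. (cmod (coord x n))\<^sup>2 = 0)"
    using suminf_eq_zero_iff[OF summable_coord[of x]] by (simp add: norm_ell2_def)
  also have "\<dots> = (x = 0)" by transfer auto
  finally show "(norm x = 0) = (x = 0)" .
  have lim: "(\<lambda>N. L2_set (\<lambda>n. cmod (coord z n)) {..<N}) \<longlonglongrightarrow> norm z" for z :: ell2
    unfolding L2_set_def norm_ell2_def
    by (intro tendsto_real_sqrt summable_LIMSEQ summable_coord)
  show "norm (x + y) \<le> norm x + norm y"
  proof (rule LIMSEQ_le[OF lim tendsto_add[OF lim lim]], intro exI allI impI)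
    fix N
    have "L2_set (\<lambda>n. cmod (coord (x + y) n)) {..<N}
        \<le> L2_set (\<lambda>n. cmod (coord x n) + cmod (coord y n)) {..<N}"
      by (rule L2_set_mono) (simp_all add: plus_ell2.rep_eq norm_triangle_ineq)
    also have "\<dots> \<le> L2_set (\<lambda>n. cmod (coord x n)) {..<N} + L2_set (\<lambda>n. cmod (coord y n)) {..<N}"
      by (rule L2_set_triangle_ineq)
    finally show "L2_set (\<lambda>n. cmod (coord (x + y) n)) {..<N}
        \<le> L2_set (\<lambda>n. cmod (coord x n)) {..<N} + L2_set (\<lambda>n. cmod (coord y n)) {..<N}" .
  qed
qed

end

definition real_ell2 :: "ell2 set"
  where "real_ell2 = {x. \<forall>n. coord x n \<in> \<real>}"

section \<open>Varopoulos operators\<close>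

definition sharp :: "ell2 \<Rightarrow> ell2 \<Rightarrow> complex"
  where "sharp x y = suminf (\<lambda>n. coord x n * coord y n)"

type_synonym vspace = "complex \<times> ell2 \<times> complex"

definition varopoulos :: "ell2 \<Rightarrow> vspace \<Rightarrow> vspace"
  where "varopoulos x = (\<lambda>(a, h, b). (sharp x h, b *\<^sub>C x, 0))"

definition delta3 :: "((vspace \<Rightarrow> vspace)^3) set"
  where "delta3 = {(\<chi> j. varopoulos (x $ j)) |x :: ell2^3.
           \<forall>j. x $ j \<in> real_ell2 \<and> norm (x $ j) \<le> 1}"

lemma norm_prods_le_ell2:
  "summable (\<lambda>n. cmod (coord x n * coord y n))"
  "suminf (\<lambda>n. cmod (coord x n * coord y n)) \<le> norm x * norm y"
proof -
  have *: "(\<Sum>n<N. cmod (coord x n * coord y n)) \<le> norm x * norm y" for N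
  proof -
    have le: "L2_set (\<lambda>n. cmod (coord z n)) {..<N} \<le> norm z" for z :: ell2
      unfolding L2_set_def norm_ell2_def
      by (intro real_sqrt_le_mono sum_le_suminf summable_coord) auto
    have "(\<Sum>n<N. cmod (coord x n * coord y n))
        \<le> L2_set (\<lambda>n. cmod (coord x n)) {..<N} * L2_set (\<lambda>n. cmod (coord y n)) {..<N}"
      using L2_set_mult_ineq[of "\<lambda>n. cmod (coord x n)" "\<lambda>n. cmod (coord y n)" "{..<N}"]
      by (simp add: norm_mult)
    also have "\<dots> \<le> norm x * norm y"
      by (intro mult_mono le) auto
    finally show ?thesis .
  qed
  show s: "summable (\<lambda>n. cmod (coord x n * coord y n))"
    by (rule bounded_imp_summable[of _ "norm x * norm y"])
      (use *[of "Suc _"] in \<open>simp_all only: lessThan_Suc_atMost norm_ge_zero\<close>)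
  show "suminf (\<lambda>n. cmod (coord x n * coord y n)) \<le> norm x * norm y"
    by (rule suminf_le_const[OF s *])
qed

lemma summable_sharp: "summable (\<lambda>n. coord x n * coord y n)"
  by (rule summable_norm_cancel[OF norm_prods_le_ell2(1)])

lemma norm_sharp_le: "cmod (sharp x y) \<le> norm x * norm y"
  unfolding sharp_def
  using summable_norm[OF norm_prods_le_ell2(1)] norm_prods_le_ell2(2) by (rule order_trans)

lemma sharp_add_right: "sharp x (y + z) = sharp x y + sharp x z"
  by (simp add: sharp_def plus_ell2.rep_eq algebra_simps suminf_add summable_sharp)

lemma sharp_scaleC_right: "sharp x (c *\<^sub>C y) = c * sharp x y"
  using suminf_mult[OF summable_sharp[of x y], of c]
  by (simp add: sharp_def scaleC_ell2.rep_eq mult.left_commute)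

lemma sharp_commute: "sharp x y = sharp y x"
  by (simp add: sharp_def mult.commute)

lemma varopoulos_add: "varopoulos x (v + w) = varopoulos x v + varopoulos x w"
  by (simp add: varopoulos_def split_beta sharp_add_right scaleC_add_left)

lemma varopoulos_scaleC: "varopoulos x (c *\<^sub>C v) = c *\<^sub>C varopoulos x v"
  by (simp add: varopoulos_def split_beta scaleC_prod_def sharp_scaleC_right scaleC_scaleC
      scaleC_complex_def)

lemma varopoulos_commute: "varopoulos x \<circ> varopoulos y = varopoulos y \<circ> varopoulos x"
  by (simp add: varopoulos_def fun_eq_iff sharp_scaleC_right sharp_commute scaleC_prod_def
      scaleC_ell2.rep_eq ell2_eqI zero_ell2.rep_eq)

lemma norm_varopoulos_le: "norm (varopoulos x v) \<le> norm x * norm v"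
proof -
  obtain a h b where v: "v = (a, h, b)" by (cases v)
  have "(cmod (sharp x h))\<^sup>2 + (cmod b * norm x)\<^sup>2 \<le> (norm x * norm h)\<^sup>2 + (cmod b * norm x)\<^sup>2"
    by (simp add: power_mono norm_sharp_le)
  also have "\<dots> \<le> (norm x)\<^sup>2 * ((cmod a)\<^sup>2 + ((norm h)\<^sup>2 + (cmod b)\<^sup>2))"
    by (simp add: algebra_simps power_mult_distrib)
  finally have "sqrt ((cmod (sharp x h))\<^sup>2 + (cmod b * norm x)\<^sup>2)
      \<le> sqrt ((norm x)\<^sup>2 * ((cmod a)\<^sup>2 + ((norm h)\<^sup>2 + (cmod b)\<^sup>2)))"
    by (rule real_sqrt_le_mono)
  then show ?thesis
    by (simp add: v varopoulos_def norm_Pair norm_scaleC real_sqrt_mult)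
qed

section \<open>Complex polynomials in three variables\<close>

text \<open>
  A polynomial is a finitely supported map from exponent vectors to coefficients, with the
  convolution product supplied by the library.
\<close>

type_synonym mpoly3 = "(3 \<Rightarrow>\<^sub>0 nat) \<Rightarrow>\<^sub>0 complex"

definition Const :: "complex \<Rightarrow> mpoly3"
  where "Const c = Poly_Mapping.single 0 c"

definition Z :: "3 \<Rightarrow> mpoly3"
  where "Z j = Poly_Mapping.single (Poly_Mapping.single j 1) 1"

definition eval_at :: "mpoly3 \<Rightarrow> complex^3 \<Rightarrow> complex"
  where "eval_at p z = (\<Sum>m\<in>Poly_Mapping.keys p.
           Poly_Mapping.lookup p m * (\<Prod>j\<in>UNIV. (z $ j) ^ Poly_Mapping.lookup m j))"

text \<open>
  Only used for commuting triples, so that the order of the factors is immaterial.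
\<close>

definition monom_op :: "(3 \<Rightarrow>\<^sub>0 nat) \<Rightarrow> ('v \<Rightarrow> 'v)^3 \<Rightarrow> 'v \<Rightarrow> 'v"
  where "monom_op m T = (T $ 1 ^^ Poly_Mapping.lookup m 1) \<circ> (T $ 2 ^^ Poly_Mapping.lookup m 2)
           \<circ> (T $ 3 ^^ Poly_Mapping.lookup m 3)"

definition eval_op :: "mpoly3 \<Rightarrow> ('v \<Rightarrow> 'v)^3 \<Rightarrow> 'v \<Rightarrow> 'v::complex_normed_vector"
  where "eval_op p T v = (\<Sum>m\<in>Poly_Mapping.keys p. Poly_Mapping.lookup p m *\<^sub>C monom_op m T v)"

definition polydisc :: "(complex^3) set"
  where "polydisc = {z. \<forall>j. cmod (z $ j) < 1}"

definition polydisc_norm :: "mpoly3 \<Rightarrow> real"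
  where "polydisc_norm p = (SUP z\<in>polydisc. cmod (eval_at p z))"

definition rho :: "mpoly3 \<Rightarrow> real"
  where "rho p = (SUP T\<in>delta3. onorm (eval_op p T)) / polydisc_norm p"

definition quad_poly :: "complex^3^3 \<Rightarrow> mpoly3"
  where "quad_poly A = (\<Sum>j\<in>UNIV. \<Sum>k\<in>UNIV. Const (A $ j $ k) * Z j * Z k)"

definition p_VK :: mpoly3
  where "p_VK = Z 1 ^ 2 + Z 2 ^ 2 + Z 3 ^ 2 - 2 * Z 1 * Z 2 - 2 * Z 2 * Z 3 - 2 * Z 3 * Z 1"

definition B_mat :: "real \<Rightarrow> complex^3^3"
  where "B_mat \<alpha> = vector [vector [1, 1, 1],
                             vector [1, 1, complex_of_real \<alpha>],
                             vector [1, complex_of_real \<alpha>, 1]]"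

text \<open>The evaluations are additive, and on quadratic polynomials they are the expected sums.\<close>

lemma lookup_sum_superset:
  fixes p :: "'a \<Rightarrow>\<^sub>0 'b::zero"
  assumes "finite S" "Poly_Mapping.keys p \<subseteq> S" "\<And>m. f m 0 = (0 :: 'c::comm_monoid_add)"
  shows "(\<Sum>m\<in>Poly_Mapping.keys p. f m (Poly_Mapping.lookup p m))
       = (\<Sum>m\<in>S. f m (Poly_Mapping.lookup p m))"
  using assms by (intro sum.mono_neutral_left) (auto simp: in_keys_iff)

lemma eval_at_add: "eval_at (p + q) z = eval_at p z + eval_at q z"
proof -
  let ?S = "Poly_Mapping.keys p \<union> Poly_Mapping.keys q"
  let ?f = "\<lambda>m c. c * (\<Prod>j\<in>UNIV. (z $ j) ^ Poly_Mapping.lookup m j)"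
  have "eval_at r z = (\<Sum>m\<in>?S. ?f m (Poly_Mapping.lookup r m))"
    if "Poly_Mapping.keys r \<subseteq> ?S" for r
    unfolding eval_at_def using that by (intro lookup_sum_superset) auto
  then show ?thesis
    by (simp add: Poly_Mapping.keys_add lookup_add distrib_right sum.distrib)
qed

lemma scaleC_zero_left: "0 *\<^sub>C x = (0 :: 'v::complex_normed_vector)"
  using scaleC_of_real[of 0 x] by simp

lemma eval_op_add: "eval_op (p + q) T v = eval_op p T v + eval_op q T v"
proof -
  let ?S = "Poly_Mapping.keys p \<union> Poly_Mapping.keys q"
  let ?f = "\<lambda>m c. c *\<^sub>C monom_op m T v"
  have "eval_op r T v = (\<Sum>m\<in>?S. ?f m (Poly_Mapping.lookup r m))"
    if "Poly_Mapping.keys r \<subseteq> ?S" for r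
    unfolding eval_op_def using that by (intro lookup_sum_superset) (auto simp: scaleC_zero_left)
  then show ?thesis
    by (simp add: Poly_Mapping.keys_add lookup_add scaleC_add_left sum.distrib)
qed

lemma eval_at_single:
  "eval_at (Poly_Mapping.single m c) z = c * (\<Prod>j\<in>UNIV. (z $ j) ^ Poly_Mapping.lookup m j)"
  by (simp add: eval_at_def)

lemma eval_op_single: "eval_op (Poly_Mapping.single m c) T v = c *\<^sub>C monom_op m T v"
  by (simp add: eval_op_def scaleC_zero_left)

lemma eval_at_sum: "finite S \<Longrightarrow> eval_at (\<Sum>i\<in>S. p i) z = (\<Sum>i\<in>S. eval_at (p i) z)"
  by (induction S rule: finite_induct) (simp_all add: eval_at_add, simp add: eval_at_def)

lemma eval_op_sum: "finite S \<Longrightarrow> eval_op (\<Sum>i\<in>S. p i) T v = (\<Sum>i\<in>S. eval_op (p i) T v)"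
  by (induction S rule: finite_induct) (simp_all add: eval_op_add, simp add: eval_op_def)

lemma quadratic_term:
  "Const c * Z j * Z k
     = Poly_Mapping.single (Poly_Mapping.single j 1 + Poly_Mapping.single k 1) c"
  by (simp add: Const_def Z_def mult_single)

lemma eval_at_quad_poly:
  "eval_at (quad_poly A) z = (\<Sum>j\<in>UNIV. \<Sum>k\<in>UNIV. A $ j $ k * z $ j * z $ k)"
proof -
  have "(\<Prod>j\<in>UNIV. (z $ j) ^ Poly_Mapping.lookup (Poly_Mapping.single i 1) j)
      = (\<Prod>j\<in>UNIV. if j = i then z $ j else 1)" for i
    by (rule prod.cong) (auto simp: lookup_single when_def)
  then have "eval_at (Const c * Z j * Z k) z = c * z $ j * z $ k" for c j k
    unfolding quadratic_term eval_at_single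
    by (simp add: lookup_add power_add prod.distrib)
  then show ?thesis by (simp add: quad_poly_def eval_at_sum)
qed

lemma eval_op_quad_poly:
  assumes "T \<in> delta3"
  shows "eval_op (quad_poly A) T v = (\<Sum>j\<in>UNIV. \<Sum>k\<in>UNIV. A $ j $ k *\<^sub>C (T $ j) ((T $ k) v))"
proof -
  have comm: "(T $ i) ((T $ j) w) = (T $ j) ((T $ i) w)" for i j w
    using assms varopoulos_commute[THEN fun_cong, of _ _ w] by (auto simp: delta3_def)
  have "monom_op (Poly_Mapping.single j 1 + Poly_Mapping.single k 1) T v = (T $ j) ((T $ k) v)"
    for j k
    using exhaust_3[of j] exhaust_3[of k]
    by (auto simp: monom_op_def lookup_add lookup_single when_def comm)
  then have "eval_op (Const c * Z j * Z k) T v = c *\<^sub>C (T $ j) ((T $ k) v)" for c j k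
    unfolding quadratic_term eval_op_single by simp
  then show ?thesis by (simp add: quad_poly_def eval_op_sum)
qed

lemma p_VK_eq_quad_poly:
  "p_VK = quad_poly (vector [vector [1, -1, -1], vector [-1, 1, -1], vector [-1, -1, 1]])"
proof -
  have "Const 1 = 1" "Const (- 1) = - 1"
    by (simp_all add: Const_def single_uminus)
  then show ?thesis
    by (simp add: p_VK_def quad_poly_def sum_3 power2_eq_square algebra_simps)
qed

text \<open>Both suprema in \<open>rho\<close> are suprema of bounded sets of reals.\<close>

lemma bdd_above_polydisc: "bdd_above ((\<lambda>z. cmod (eval_at p z)) ` polydisc)"
proof (rule bdd_aboveI2)
  fix z assume z: "z \<in> polydisc"
  have "cmod (eval_at p z) \<le> (\<Sum>m\<in>Poly_Mapping.keys p. cmod (Poly_Mapping.lookup p m) * 1)"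
    unfolding eval_at_def
  proof (rule order_trans[OF norm_sum], rule sum_mono, unfold norm_mult, rule mult_left_mono)
    fix m :: "3 \<Rightarrow>\<^sub>0 nat"
    show "cmod (\<Prod>j\<in>UNIV. (z $ j) ^ Poly_Mapping.lookup m j) \<le> 1"
      using z unfolding prod_norm[symmetric]
      by (intro prod_le_1) (auto simp: norm_power polydisc_def less_imp_le power_le_one)
  qed simp
  then show "cmod (eval_at p z) \<le> (\<Sum>m\<in>Poly_Mapping.keys p. cmod (Poly_Mapping.lookup p m))"
    by simp
qed

lemma norm_eval_op_le:
  assumes "T \<in> delta3"
  shows "norm (eval_op p T v) \<le> (\<Sum>m\<in>Poly_Mapping.keys p. cmod (Poly_Mapping.lookup p m)) * norm v"
proof -
  have contr: "norm ((T $ j) w) \<le> norm w" for j w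
  proof -
    obtain x :: "ell2^3" where "T $ j = varopoulos (x $ j)" "norm (x $ j) \<le> 1"
      using assms by (auto simp: delta3_def)
    then show ?thesis
      using norm_varopoulos_le[of "x $ j" w] mult_right_mono[of "norm (x $ j)" 1 "norm w"] by simp
  qed
  have pow: "norm ((T $ j ^^ n) w) \<le> norm w" for j n w
    by (induction n) (use contr order_trans in \<open>auto, blast\<close>)
  have "norm (monom_op m T v) \<le> norm v" for m
    unfolding monom_op_def o_def using pow by (meson order_trans)
  then show ?thesis
    unfolding eval_op_def sum_distrib_right
    by (intro order_trans[OF norm_sum] sum_mono) (simp add: norm_scaleC mult_left_mono)
qed

lemma bdd_above_delta3: "bdd_above ((\<lambda>T. onorm (eval_op p T)) ` delta3)"
  by (rule bdd_aboveI2[where M = "\<Sum>m\<in>Poly_Mapping.keys p. cmod (Poly_Mapping.lookup p m)"])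
    (rule onorm_bound[OF _ norm_eval_op_le], auto intro: sum_nonneg)

end

theory Submission
  imports Defs "HOL-Complex_Analysis.Conformal_Mappings"
begin

text \<open>
  A product \<open>T\<^sub>x T\<^sub>y\<close> of Varopoulos operators maps \<open>(a, h, b)\<close> to \<open>(b \<langle>x, y\<rangle>, 0, 0)\<close>, so
  \<open>p\<^sub>A(T)\<close> has norm \<open>\<bar>\<Sum> a\<^sub>j\<^sub>k \<langle>x\<^sub>j, x\<^sub>k\<rangle>\<bar>\<close> and the numerator of \<open>\<rho>\<close> is the supremum of the modulus
  of this form over Gram matrices of three real vectors in the unit ball.

  The value \<open>6/5\<close> separates the polynomials. For the Varopoulos--Kaijser polynomial, three unit
  vectors at angles of 120 degrees give 6 in the numerator (\<open>rho_VK_ge\<close>), while the polynomial is at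
  most 5 on the polydisc: on the torus this is an explicit inequality in two cosines
  (\<open>vk_trig_nonneg\<close>), and the maximum modulus principle in each variable does the rest.

  All competitors satisfy \<open>\<rho> \<le> 6/5\<close>, and for the denominator it is enough to evaluate them at points
  with coordinates \<open>1\<close> and \<open>-1\<close>. The numerator is estimated through positivity of the Gram matrix,
  tested on suitable vectors of coefficients (\<open>gram_nonneg\<close>). For a sign matrix with off-diagonal
  entries \<open>d, e, f\<close>, the product \<open>d e f\<close> decides which test vectors to use
  (\<open>sign_form_le\<close>); for \<open>B\<^sub>\<alpha>\<close> with \<open>\<alpha>\<close> clearly negative, the right one is
  \<open>(1, \<alpha>, \<alpha>)\<close>, that is, \<open>\<parallel>x\<^sub>1 + \<alpha> (x\<^sub>2 + x\<^sub>3)\<parallel>\<^sup>2 \<ge> 0\<close> (\<open>rho_B_mat\<close>).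
\<close>

section \<open>Real square-summable sequences\<close>

abbreviation form :: "complex^3^3 \<Rightarrow> ell2^3 \<Rightarrow> complex"
  where "form A x \<equiv> \<Sum>j\<in>UNIV. \<Sum>k\<in>UNIV. A $ j $ k * sharp (x $ j) (x $ k)"

text \<open>
  The real part makes this a real-bilinear form on the whole space; on real sequences it
  is the inner product and determines \<open>sharp\<close>.
\<close>

definition rinner :: "ell2 \<Rightarrow> ell2 \<Rightarrow> real"
  where "rinner x y = Re (sharp x y)"

lemma rinner_commute: "rinner x y = rinner y x"
  by (simp add: rinner_def sharp_commute)

lemma rinner_add_right: "rinner x (y + z) = rinner x y + rinner x z"
  by (simp add: rinner_def sharp_add_right)

lemma rinner_scale_right: "rinner x (complex_of_real r *\<^sub>C y) = r * rinner x y"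
  by (simp add: rinner_def sharp_scaleC_right)

lemma rinner_add_left: "rinner (x + y) z = rinner x z + rinner y z"
  using rinner_add_right[of z x y] by (simp add: rinner_commute)

lemma rinner_scale_left: "rinner (complex_of_real r *\<^sub>C x) y = r * rinner x y"
  using rinner_scale_right[of y r x] by (simp add: rinner_commute)

lemma abs_rinner_le: "\<bar>rinner x y\<bar> \<le> norm x * norm y"
  unfolding rinner_def using abs_Re_le_cmod norm_sharp_le by (rule order_trans)

lemma real_ell2_add: "x \<in> real_ell2 \<Longrightarrow> y \<in> real_ell2 \<Longrightarrow> x + y \<in> real_ell2"
  by (simp add: real_ell2_def plus_ell2.rep_eq)

lemma real_ell2_scale: "x \<in> real_ell2 \<Longrightarrow> complex_of_real r *\<^sub>C x \<in> real_ell2"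
  by (simp add: real_ell2_def scaleC_ell2.rep_eq)

lemma sharp_eq_rinner:
  assumes "x \<in> real_ell2" "y \<in> real_ell2"
  shows "sharp x y = complex_of_real (rinner x y)"
proof -
  have "sharp x y = suminf (\<lambda>n. complex_of_real (Re (coord x n * coord y n)))"
    using assms unfolding sharp_def real_ell2_def
    by (intro suminf_cong) (auto simp: complex_eq_iff complex_is_Real_iff)
  also have "\<dots> = complex_of_real (suminf (\<lambda>n. Re (coord x n * coord y n)))"
    by (intro suminf_of_real[symmetric] summable_Re summable_sharp)
  finally show ?thesis by (simp add: rinner_def)
qed

lemma rinner_self:
  assumes "x \<in> real_ell2"
  shows "rinner x x = (norm x)\<^sup>2"
proof -
  have "sharp x x = suminf (\<lambda>n. complex_of_real ((cmod (coord x n))\<^sup>2))"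
    using assms unfolding sharp_def real_ell2_def
    by (intro suminf_cong) (simp add: complex_is_Real_iff complex_eq_iff cmod_def power2_eq_square)
  also have "\<dots> = complex_of_real (suminf (\<lambda>n. (cmod (coord x n))\<^sup>2))"
    by (intro suminf_of_real[symmetric] summable_coord)
  also have "\<dots> = complex_of_real ((norm x)\<^sup>2)"
    by (simp add: norm_ell2_def suminf_nonneg summable_coord)
  finally show ?thesis by (simp add: rinner_def)
qed

text \<open>This is \<open>\<parallel>a x + b y + c z\<parallel>\<^sup>2 \<ge> 0\<close>, expanded so that it is linear in the Gram entries.\<close>

lemma gram_nonneg:
  assumes "x \<in> real_ell2" "y \<in> real_ell2" "z \<in> real_ell2"
  shows "0 \<le> a\<^sup>2 * rinner x x + b\<^sup>2 * rinner y y + c\<^sup>2 * rinner z z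
           + 2 * a * b * rinner x y + 2 * a * c * rinner x z + 2 * b * c * rinner y z"
proof -
  let ?v = "complex_of_real a *\<^sub>C x + complex_of_real b *\<^sub>C y + complex_of_real c *\<^sub>C z"
  have "0 \<le> rinner ?v ?v"
    using assms by (subst rinner_self) (simp_all add: real_ell2_add real_ell2_scale)
  then show ?thesis
    by (simp add: rinner_add_left rinner_add_right rinner_scale_left rinner_scale_right
        rinner_commute[of y x] rinner_commute[of z x] rinner_commute[of z y]
        power2_eq_square algebra_simps)
qed

lemma form_eq_rinner:
  fixes a :: "3 \<Rightarrow> 3 \<Rightarrow> real"
  assumes "\<And>j k. A $ j $ k = complex_of_real (a j k)" "\<And>j k. a j k = a k j"
    and "\<And>j. x $ j \<in> real_ell2"
  shows "form A x = complex_of_real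
    (a 1 1 * rinner (x$1) (x$1) + a 2 2 * rinner (x$2) (x$2) + a 3 3 * rinner (x$3) (x$3)
     + 2 * a 1 2 * rinner (x$1) (x$2) + 2 * a 1 3 * rinner (x$1) (x$3)
     + 2 * a 2 3 * rinner (x$2) (x$3))"
  using assms(2)[of 2 1] assms(2)[of 3 1] assms(2)[of 3 2]
  by (simp add: sum_3 sharp_eq_rinner assms(1,3) rinner_commute[of "x$2" "x$1"]
      rinner_commute[of "x$3" "x$1"] rinner_commute[of "x$3" "x$2"])

section \<open>Norms of quadratic polynomials\<close>

text \<open>
  The operator only reads the last component and writes the first one, so its norm is
  attained at \<open>(0, 0, 1)\<close>.
\<close>

lemma onorm_eval_op_quad_poly:
  assumes "\<And>j. x $ j \<in> real_ell2" "\<And>j. norm (x $ j) \<le> 1"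
  shows "onorm (eval_op (quad_poly A) (\<chi> j. varopoulos (x $ j))) = cmod (form A x)"
proof -
  let ?T = "\<chi> j. varopoulos (x $ j)" and ?c = "form A x"
  have T: "?T \<in> delta3" using assms by (auto simp: delta3_def)
  have eq: "eval_op (quad_poly A) ?T v = (?c * snd (snd v), 0, 0)" for v
  proof -
    have TT: "varopoulos y (varopoulos z v) = (snd (snd v) * sharp y z, 0, 0)" for y z
      by (cases v) (simp add: varopoulos_def sharp_scaleC_right scaleC_zero_left)
    have zero: "d *\<^sub>C (0::ell2) = 0" for d
      by (rule ell2_eqI) (simp add: scaleC_ell2.rep_eq zero_ell2.rep_eq)
    show ?thesis
      by (simp add: eval_op_quad_poly[OF T] TT sum_3 scaleC_prod_def zero scaleC_complex_def
          algebra_simps)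
  qed
  show ?thesis
  proof (rule antisym)
    show "onorm (eval_op (quad_poly A) ?T) \<le> cmod ?c"
    proof (rule onorm_bound)
      fix v :: vspace
      obtain a h b where v: "v = (a, h, b)" by (cases v)
      have "cmod b \<le> norm v"
        using norm_snd_le[of b h] norm_snd_le[of "(h, b)" a] by (simp add: v)
      then show "norm (eval_op (quad_poly A) ?T v) \<le> cmod ?c * norm v"
        by (simp add: eq v norm_Pair norm_mult mult_left_mono)
    qed simp
    have "bounded_linear (\<lambda>v::vspace. (?c * snd (snd v), 0::ell2, 0::complex))"
      by (intro bounded_linear_Pair bounded_linear_zero bounded_linear_compose[OF bounded_linear_mult_right]
          bounded_linear_compose[OF bounded_linear_snd] bounded_linear_snd)
    then have "bounded_linear (eval_op (quad_poly A) ?T)"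
      by (simp add: eq[abs_def])
    from onorm[OF this, of "(0, 0, 1)"]
    show "cmod ?c \<le> onorm (eval_op (quad_poly A) ?T)"
      by (simp add: eq norm_Pair)
  qed
qed

lemma cmod_form_le_SUP:
  assumes "\<And>j. x $ j \<in> real_ell2" "\<And>j. norm (x $ j) \<le> 1"
  shows "cmod (form A x) \<le> (SUP T\<in>delta3. onorm (eval_op (quad_poly A) T))"
proof -
  have "(\<chi> j. varopoulos (x $ j)) \<in> delta3" using assms by (auto simp: delta3_def)
  from cSUP_upper[OF this bdd_above_delta3, of "quad_poly A"] show ?thesis
    by (simp only: onorm_eval_op_quad_poly[OF assms])
qed

text \<open>
  The polydisc is open, but boundary points may be used as well: by homogeneity,
  \<open>p(r z) = r\<^sup>2 p(z)\<close>, and \<open>r\<close> tends to 1 from below.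
\<close>

lemma polydisc_norm_ge:
  assumes "\<And>j. cmod (z $ j) \<le> 1"
  shows "cmod (\<Sum>j\<in>UNIV. \<Sum>k\<in>UNIV. A $ j $ k * z $ j * z $ k) \<le> polydisc_norm (quad_poly A)"
    (is "?q \<le> ?S")
proof -
  have le: "r\<^sup>2 * ?q \<le> ?S" if r: "0 < r" "r < 1" for r :: real
  proof -
    let ?z = "\<chi> j. complex_of_real r * z $ j"
    have "cmod (?z $ j) < 1" for j
    proof -
      have "r * cmod (z $ j) \<le> r" using mult_left_le[OF assms[of j], of r] r by simp
      also have "\<dots> < 1" by (rule r(2))
      finally show ?thesis using r by (simp add: norm_mult)
    qed
    then have "?z \<in> polydisc" by (simp add: polydisc_def)
    from cSUP_upper[OF this bdd_above_polydisc]
    have "cmod (eval_at (quad_poly A) ?z) \<le> ?S"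
      by (simp add: polydisc_norm_def)
    moreover have "eval_at (quad_poly A) ?z
        = complex_of_real (r\<^sup>2) * (\<Sum>j\<in>UNIV. \<Sum>k\<in>UNIV. A $ j $ k * z $ j * z $ k)"
      by (simp add: eval_at_quad_poly sum_distrib_left power2_eq_square mult_ac)
    ultimately show ?thesis
      by (simp add: norm_mult norm_power)
  qed
  have "((\<lambda>r. r\<^sup>2 * ?q) \<longlongrightarrow> 1\<^sup>2 * ?q) (at_left (1::real))"
    by (intro tendsto_intros)
  moreover have "eventually (\<lambda>r::real. r\<^sup>2 * ?q \<le> ?S) (at_left 1)"
    using eventually_at_left_real[of 0 "1::real"] by (rule eventually_mono) (auto intro: le)
  ultimately show ?thesis
    using tendsto_upperbound[of "\<lambda>r. r\<^sup>2 * ?q" "1\<^sup>2 * ?q" "at_left (1::real)" ?S] by simp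
qed

lemma polydisc_norm_ge_real:
  fixes a :: "3 \<Rightarrow> 3 \<Rightarrow> real"
  assumes "\<And>j k. A $ j $ k = complex_of_real (a j k)" "\<And>j k. a j k = a k j"
    and "\<bar>r\<bar> \<le> 1" "\<bar>s\<bar> \<le> 1" "\<bar>t\<bar> \<le> 1"
  shows "\<bar>a 1 1 * r\<^sup>2 + a 2 2 * s\<^sup>2 + a 3 3 * t\<^sup>2 + 2 * a 1 2 * r * s + 2 * a 1 3 * r * t
          + 2 * a 2 3 * s * t\<bar> \<le> polydisc_norm (quad_poly A)"
proof -
  let ?z = "vector [complex_of_real r, complex_of_real s, complex_of_real t] :: complex^3"
  have "cmod (?z $ j) \<le> 1" for j
    using exhaust_3[of j] assms(3-5) by (auto simp: vector_3)
  note polydisc_norm_ge[of ?z A, OF this]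
  moreover have "(\<Sum>j\<in>UNIV. \<Sum>k\<in>UNIV. A $ j $ k * ?z $ j * ?z $ k)
    = complex_of_real (a 1 1 * r\<^sup>2 + a 2 2 * s\<^sup>2 + a 3 3 * t\<^sup>2 + 2 * a 1 2 * r * s
        + 2 * a 1 3 * r * t + 2 * a 2 3 * s * t)"
    using assms(2)[of 2 1] assms(2)[of 3 1] assms(2)[of 3 2]
    by (simp add: sum_3 assms(1) vector_3 power2_eq_square algebra_simps)
  ultimately show ?thesis by (simp only: norm_of_real)
qed

lemma rho_quad_poly_le:
  fixes a :: "3 \<Rightarrow> 3 \<Rightarrow> real"
  assumes A: "\<And>j k. A $ j $ k = complex_of_real (a j k)" "\<And>j k. a j k = a k j"
    and "0 \<le> C"
    and bound: "\<And>x y z. x \<in> real_ell2 \<Longrightarrow> y \<in> real_ell2 \<Longrightarrow> z \<in> real_ell2 \<Longrightarrow>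
      norm x \<le> 1 \<Longrightarrow> norm y \<le> 1 \<Longrightarrow> norm z \<le> 1 \<Longrightarrow>
      \<bar>a 1 1 * rinner x x + a 2 2 * rinner y y + a 3 3 * rinner z z + 2 * a 1 2 * rinner x y
        + 2 * a 1 3 * rinner x z + 2 * a 2 3 * rinner y z\<bar> \<le> C * polydisc_norm (quad_poly A)"
  shows "rho (quad_poly A) \<le> C"
proof -
  let ?S = "polydisc_norm (quad_poly A)" and ?N = "SUP T\<in>delta3. onorm (eval_op (quad_poly A) T)"
  have S: "0 \<le> ?S"
    using polydisc_norm_ge_real[of A a 0 0 0, OF A] by simp
  have "0 \<in> real_ell2" by (simp add: real_ell2_def zero_ell2.rep_eq)
  then have "(\<chi> j. varopoulos ((0 :: ell2^3) $ j)) \<in> delta3"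
    unfolding delta3_def by fastforce
  then have "delta3 \<noteq> {}" by blast
  then have "?N \<le> C * ?S"
  proof (rule cSUP_least)
    fix T assume "T \<in> delta3"
    then obtain x :: "ell2^3" where T: "T = (\<chi> j. varopoulos (x $ j))"
      and x: "\<And>j. x $ j \<in> real_ell2" "\<And>j. norm (x $ j) \<le> 1"
      by (auto simp: delta3_def)
    show "onorm (eval_op (quad_poly A) T) \<le> C * ?S"
      unfolding T onorm_eval_op_quad_poly[OF x] form_eq_rinner[OF A x(1)] norm_of_real
      by (intro bound x)
  qed
  then show ?thesis
    using S \<open>0 \<le> C\<close> by (cases "?S = 0") (auto simp: rho_def divide_le_eq)
qed

section \<open>The Varopoulos--Kaijser polynomial\<close>

text \<open>
  Eight times this is \<open>25 - \<bar>p\<^sub>V\<^sub>K\<bar>\<^sup>2\<close> on the torus, see \<open>vk_le_5_torus\<close>. It is a quadratic in \<open>c\<close>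
  with discriminant \<open>t\<^sup>2 (16 t\<^sup>2 - 15)\<close>. When \<open>t\<close> is so large that this is
  positive, the parabola lies above its tangent at \<open>c = -1\<close>, and the tangent is increasing, starting
  from the value \<open>(1 - t) (2 + 5 t + 6 t\<^sup>2 + 2 t\<^sup>3)\<close> at \<open>c = -1\<close>.
\<close>

lemma vk_trig_nonneg:
  fixes t c :: real
  assumes "0 \<le> t" "t \<le> 1" "\<bar>c\<bar> \<le> 1"
  shows "0 \<le> 2 * (1 - t\<^sup>2) * c\<^sup>2 + t * c * (4 * t\<^sup>2 - 3) + t\<^sup>2 * (3 - 2 * t\<^sup>2)"
proof -
  have t2: "t\<^sup>2 \<le> 1" using assms by (simp add: power_le_one)
  show ?thesis
  proof (cases "16 * t\<^sup>2 \<le> 15")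
    case True
    let ?g = "2 * (1 - t\<^sup>2) * c\<^sup>2 + t * c * (4 * t\<^sup>2 - 3) + t\<^sup>2 * (3 - 2 * t\<^sup>2)"
    have "8 * (1 - t\<^sup>2) * ?g = (4 * (1 - t\<^sup>2) * c + t * (4 * t\<^sup>2 - 3))\<^sup>2 + t\<^sup>2 * (15 - 16 * t\<^sup>2)"
      by (simp add: power2_eq_square algebra_simps)
    also have "0 \<le> \<dots>" using True by simp
    finally show ?thesis using True by (simp add: zero_le_mult_iff)
  next
    case False
    have "3/4 \<le> t"
      using False assms power_mono[of t "3/4" 2] by (cases "3/4 \<le> t") (auto simp: power2_eq_square)
    then have "(3/4) * (3/4) \<le> t * (4 * t\<^sup>2 - 3)"
      using False by (intro mult_mono) auto
    \<comment> \<open>The slope of the tangent at \<open>c = -1\<close>.\<close>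
    then have slope: "0 \<le> t * (4 * t\<^sup>2 - 3) - 4 * (1 - t\<^sup>2)"
      using False by (simp add: algebra_simps)
    have "0 \<le> (1 - t) * (2 + 5 * t + 6 * t\<^sup>2 + 2 * t ^ 3)"
      using assms by simp
    moreover have "0 \<le> (1 + c) * (t * (4 * t\<^sup>2 - 3) - 4 * (1 - t\<^sup>2))"
      using assms slope by simp
    moreover have "0 \<le> 2 * (1 - t\<^sup>2) * (1 + c)\<^sup>2"
      using t2 by simp
    ultimately show ?thesis
      by (simp add: power2_eq_square power3_eq_cube algebra_simps)
  qed
qed

text \<open>
  Dividing by a square root \<open>w\<close> of \<open>x y\<close> turns \<open>x\<close> and \<open>y\<close> into conjugate points \<open>a\<close> and \<open>cnj a\<close> of
  the circle, which leaves two angles.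
\<close>

lemma vk_le_5_torus:
  assumes "cmod x = 1" "cmod y = 1" "cmod z = 1"
  shows "cmod (x\<^sup>2 + y\<^sup>2 + z\<^sup>2 - 2 * x * y - 2 * y * z - 2 * z * x) \<le> 5"
proof -
  define w where "w = csqrt (x * y)"
  have w2: "w\<^sup>2 = x * y" by (simp add: w_def)
  then have w: "cmod w = 1"
    using assms by (metis norm_mult norm_power mult_1 norm_ge_zero power2_eq_1_iff not_one_le_zero
        le_minus_one_simps(4) le_minus_one_simps(3))
  define a c where "a = x / w" and "c = z / w"
  have w0: "w \<noteq> 0" using w by auto
  have a: "cmod a = 1" and c: "cmod c = 1" using assms w by (auto simp: a_def c_def norm_divide)
  have "a * cnj a = 1" using a by (simp add: complex_norm_square[symmetric])
  have x: "x = w * a" and z: "z = w * c" using w0 by (simp_all add: a_def c_def)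
  have "a \<noteq> 0" using a by auto
  have "w * a * y = w * w" unfolding x[symmetric] w2[symmetric] by (rule power2_eq_square)
  then have "a * y = w" using w0 by (metis mult.assoc mult_left_cancel)
  then have "a * y = a * (w * cnj a)" using \<open>a * cnj a = 1\<close> by (simp add: mult.left_commute)
  then have y: "y = w * cnj a" using \<open>a \<noteq> 0\<close> by simp
  define t s C D where "t = Re a" and "s = Im a" and "C = Re c" and "D = Im c"
  have s2: "s\<^sup>2 = 1 - t\<^sup>2" and D2: "D\<^sup>2 = 1 - C\<^sup>2"
    using a c cmod_power2[of a] cmod_power2[of c] by (simp_all add: t_def s_def C_def D_def)
  have tC: "\<bar>t\<bar> \<le> 1" "\<bar>C\<bar> \<le> 1"
    using abs_Re_le_cmod[of a] abs_Re_le_cmod[of c] a c by (simp_all add: t_def C_def)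
  define q where "q = a\<^sup>2 + (cnj a)\<^sup>2 + c\<^sup>2 - 2 * (a * cnj a) - 2 * c * (a + cnj a)"
  have "x\<^sup>2 + y\<^sup>2 + z\<^sup>2 - 2 * x * y - 2 * y * z - 2 * z * x = w\<^sup>2 * q"
    unfolding x y z q_def by (simp add: power2_eq_square algebra_simps)
  then have eq: "cmod (x\<^sup>2 + y\<^sup>2 + z\<^sup>2 - 2 * x * y - 2 * y * z - 2 * z * x) = cmod q"
    using w by (simp add: norm_mult norm_power)
  have Re: "Re q = 4 * t\<^sup>2 + 2 * C\<^sup>2 - 5 - 4 * t * C"
    using s2 D2 by (simp add: q_def t_def s_def C_def D_def power2_eq_square algebra_simps)
  have Im: "Im q = D * (2 * C - 4 * t)"
    by (simp add: q_def t_def s_def C_def D_def power2_eq_square algebra_simps)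
  have "0 \<le> 2 * (1 - t\<^sup>2) * C\<^sup>2 + t * C * (4 * t\<^sup>2 - 3) + t\<^sup>2 * (3 - 2 * t\<^sup>2)" (is "0 \<le> ?g")
    using vk_trig_nonneg[of t C] vk_trig_nonneg[of "-t" "-C"] tC by (cases "0 \<le> t") auto
  moreover have "(cmod q)\<^sup>2 = 25 - 8 * ?g"
    unfolding cmod_power2 Re Im power_mult_distrib D2
    by (simp add: power2_eq_square algebra_simps)
  ultimately have "(cmod q)\<^sup>2 \<le> 5\<^sup>2" by simp
  then show ?thesis unfolding eq by (rule power2_le_imp_le) simp
qed

lemma cmod_le_on_unit_disc:
  assumes "f holomorphic_on UNIV" "\<And>w. cmod w = 1 \<Longrightarrow> cmod (f w) \<le> B" "cmod z \<le> 1"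
  shows "cmod (f z) \<le> B"
proof (rule maximum_modulus_frontier[of f "cball 0 1"])
  show "f holomorphic_on interior (cball 0 1)" using assms(1) holomorphic_on_subset by blast
  show "continuous_on (closure (cball 0 1)) f"
    using holomorphic_on_imp_continuous_on[OF assms(1)] continuous_on_subset by blast
qed (use assms in auto)

lemma vk_le_5:
  assumes "cmod x \<le> 1" "cmod y \<le> 1" "cmod z \<le> 1"
  shows "cmod (x\<^sup>2 + y\<^sup>2 + z\<^sup>2 - 2 * x * y - 2 * y * z - 2 * z * x) \<le> 5"
proof -
  let ?p = "\<lambda>x y z :: complex. x\<^sup>2 + y\<^sup>2 + z\<^sup>2 - 2 * x * y - 2 * y * z - 2 * z * x"
  have hol: "(\<lambda>x. ?p x y z) holomorphic_on UNIV" "(\<lambda>y. ?p x y z) holomorphic_on UNIV"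
    "(\<lambda>z. ?p x y z) holomorphic_on UNIV" for x y z
    by (intro holomorphic_intros)+
  have 1: "cmod (?p x y z) \<le> 5" if "cmod y = 1" "cmod z = 1" for y z
    by (rule cmod_le_on_unit_disc[OF hol(1) _ assms(1)]) (rule vk_le_5_torus[OF _ that])
  have 2: "cmod (?p x y z) \<le> 5" if "cmod z = 1" for z
    by (rule cmod_le_on_unit_disc[OF hol(2) _ assms(2)]) (rule 1[OF _ that])
  show ?thesis
    by (rule cmod_le_on_unit_disc[OF hol(3) _ assms(3)]) (rule 2)
qed

definition VK_mat :: "complex^3^3"
  where "VK_mat = vector [vector [1, -1, -1], vector [-1, 1, -1], vector [-1, -1, 1]]"

lemma polydisc_norm_VK: "polydisc_norm p_VK \<le> 5" "0 < polydisc_norm p_VK"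
proof -
  have "0 \<in> polydisc" by (simp add: polydisc_def)
  then have "polydisc \<noteq> {}" by blast
  then show "polydisc_norm p_VK \<le> 5"
    unfolding polydisc_norm_def
  proof (rule cSUP_least)
    fix z assume "z \<in> polydisc"
    then have "cmod (z $ j) \<le> 1" for j by (simp add: polydisc_def less_imp_le)
    from vk_le_5[OF this[of 1] this[of 2] this[of 3]]
    show "cmod (eval_at p_VK z) \<le> 5"
      by (simp add: p_VK_eq_quad_poly eval_at_quad_poly sum_3 vector_3 power2_eq_square
          algebra_simps)
  qed
  show "0 < polydisc_norm p_VK"
    using polydisc_norm_ge[of "\<chi> j. 1" VK_mat]
    by (simp add: p_VK_eq_quad_poly VK_mat_def sum_3 vector_3)
qed

lift_definition plane_vec :: "real \<Rightarrow> real \<Rightarrow> ell2"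
  is "\<lambda>r s n. if n = 0 then complex_of_real r else if n = 1 then complex_of_real s else 0"
  by (rule summable_finite[of "{0, 1}"]) auto

lemma plane_vec_real: "plane_vec r s \<in> real_ell2"
  by (simp add: real_ell2_def plane_vec.rep_eq)

lemma rinner_plane_vec: "rinner (plane_vec r s) (plane_vec r' s') = r * r' + s * s'"
  unfolding rinner_def sharp_def
  by (subst suminf_finite[of "{0, 1}"]) (auto simp: plane_vec.rep_eq)

lemma norm_plane_vec: "norm (plane_vec r s) = sqrt (r\<^sup>2 + s\<^sup>2)"
  using rinner_self[OF plane_vec_real, of r s]
  by (simp add: rinner_plane_vec flip: power2_eq_square)

text \<open>
  Since \<open>p\<^sub>V\<^sub>K\<close> gives \<open>2 \<Sum> \<parallel>x\<^sub>j\<parallel>\<^sup>2 - \<parallel>x\<^sub>1 + x\<^sub>2 + x\<^sub>3\<parallel>\<^sup>2\<close>, unit vectors with sum zero are optimal.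
\<close>

lemma rho_VK_ge: "6 / 5 \<le> rho p_VK"
proof -
  let ?N = "SUP T\<in>delta3. onorm (eval_op p_VK T)"
  define x :: "ell2^3" where "x = vector [plane_vec 1 0, plane_vec (-1/2) (sqrt 3 / 2),
    plane_vec (-1/2) (- sqrt 3 / 2)]"
  have comp: "x $ 1 = plane_vec 1 0" "x $ 2 = plane_vec (-1/2) (sqrt 3 / 2)"
    "x $ 3 = plane_vec (-1/2) (- sqrt 3 / 2)"
    by (simp_all add: x_def vector_3)
  have x: "x $ j \<in> real_ell2" "norm (x $ j) \<le> 1" for j
    using exhaust_3[of j] by (auto simp: comp plane_vec_real norm_plane_vec power_divide)
  have "form VK_mat x = 6"
    by (simp add: sum_3 sharp_eq_rinner x(1) VK_mat_def vector_3)
       (simp add: comp rinner_plane_vec)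
  then have N: "6 \<le> ?N"
    using cmod_form_le_SUP[OF x, of VK_mat] by (simp add: p_VK_eq_quad_poly VK_mat_def)
  have "6 / 5 \<le> ?N / 5" using N by simp
  also have "\<dots> \<le> ?N / polydisc_norm p_VK"
    using N polydisc_norm_VK by (intro divide_left_mono) auto
  finally show ?thesis by (simp add: rho_def)
qed

section \<open>Sign matrices and the matrices B\<close>

text \<open>
  Here \<open>a, b, c\<close> are the diagonal and \<open>d, e, f\<close> the off-diagonal entries of the matrix, and \<open>S\<close>
  dominates the modulus of the form at the four sign vectors. If \<open>d e f = 1\<close>, one sign vector makes
  all off-diagonal terms positive, which gives \<open>a + b + c + 6\<close>; the Gram form has this bound too.
  If \<open>d e f = -1\<close>, the matrix agrees off the diagonal with minus a sign matrix of rank one, so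
  that \<open>gram3\<close> bounds the off-diagonal terms by \<open>n1 + n2 + n3\<close>; the sign vectors still give
  \<open>a + b + c + 2\<close> and \<open>6 - (a + b + c)\<close>. Here \<open>a = b = c = 1\<close>
  is Varopoulos--Kaijser up to signs of the variables, and its bounds 6 and 5 force the factor \<open>6/5\<close>.
\<close>

lemma sign_form_le:
  fixes n1 n2 n3 u v w S :: real
  assumes sgn: "a \<in> {1, -1}" "b \<in> {1, -1}" "c \<in> {1, -1}"
      "d \<in> {1, -1}" "e \<in> {1, -1}" "f \<in> {1, -1}"
    and n: "n1 \<le> 1" "n2 \<le> 1" "n3 \<le> 1"
    and gram2: "\<bar>2 * u\<bar> \<le> n1 + n2" "\<bar>2 * v\<bar> \<le> n1 + n3" "\<bar>2 * w\<bar> \<le> n2 + n3"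
    and gram3: "0 \<le> n1 + n2 + n3 + 2 * u + 2 * v + 2 * w"
      "0 \<le> n1 + n2 + n3 + 2 * u - 2 * v - 2 * w"
      "0 \<le> n1 + n2 + n3 - 2 * u + 2 * v - 2 * w"
      "0 \<le> n1 + n2 + n3 - 2 * u - 2 * v + 2 * w"
    and S: "\<bar>a + b + c + 2 * d + 2 * e + 2 * f\<bar> \<le> S" "\<bar>a + b + c + 2 * d - 2 * e - 2 * f\<bar> \<le> S"
      "\<bar>a + b + c - 2 * d + 2 * e - 2 * f\<bar> \<le> S" "\<bar>a + b + c - 2 * d - 2 * e + 2 * f\<bar> \<le> S"
  shows "a * n1 + b * n2 + c * n3 + 2 * d * u + 2 * e * v + 2 * f * w \<le> 6 / 5 * S" (is "?Q \<le> _")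
proof -
  have off: "d = 1 \<or> d = -1" "e = 1 \<or> e = -1" "f = 1 \<or> f = -1" using sgn by auto
  then consider "d * e * f = 1" | "d * e * f = - 1" by force
  then show ?thesis
  proof cases
    case 1
    have "2 * d * u \<le> n1 + n2" using gram2(1) off(1) by auto
    moreover have "2 * e * v \<le> n1 + n3" using gram2(2) off(2) by auto
    moreover have "2 * f * w \<le> n2 + n3" using gram2(3) off(3) by auto
    moreover have "(a + 2) * n1 \<le> a + 2" "(b + 2) * n2 \<le> b + 2" "(c + 2) * n3 \<le> c + 2"
      using n sgn(1-3) by auto
    ultimately have "?Q \<le> a + b + c + 6"
      by (simp add: algebra_simps)
    moreover have "a + b + c + 6 \<le> S"
      using off 1 by (elim disjE; use S[unfolded abs_le_iff] in simp)
    moreover have "-3 \<le> a + b + c" using sgn(1-3) by auto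
    ultimately show ?thesis by linarith
  next
    case 2
    have "0 \<le> n1 + n2 + n3 - 2 * d * u - 2 * e * v - 2 * f * w"
      using off 2 by (elim disjE; use gram3 in simp)
    moreover have "(a + 1) * n1 \<le> a + 1" "(b + 1) * n2 \<le> b + 1" "(c + 1) * n3 \<le> c + 1"
      using n sgn(1-3) by auto
    ultimately have "?Q \<le> a + b + c + 3"
      by (simp add: algebra_simps)
    moreover have "a + b + c + 2 \<le> S" "6 - (a + b + c) \<le> S"
      using off 2 by (elim disjE; use S[unfolded abs_le_iff] in simp)+
    moreover have "a + b + c = 3 \<or> a + b + c \<le> 1" using sgn(1-3) by auto
    ultimately show ?thesis by linarith
  qed
qed

lemma rho_sign_matrix:
  assumes sym: "transpose A = A" and sgn: "\<And>j k. A $ j $ k \<in> {1, -1}"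
  shows "rho (quad_poly A) \<le> 6 / 5"
proof -
  define a where "a j k = Re (A $ j $ k)" for j k
  have A: "A $ j $ k = complex_of_real (a j k)" for j k
    using sgn[of j k] by (auto simp: a_def)
  have a_sym: "a j k = a k j" for j k
  proof -
    have "A $ j $ k = transpose A $ k $ j" by (simp add: transpose_def)
    then show ?thesis by (simp add: sym a_def)
  qed
  have a: "a j k \<in> {1, -1}" and ma: "- a j k \<in> {1, -1}" for j k
    using sgn[of j k] by (auto simp: a_def)
  let ?S = "polydisc_norm (quad_poly A)"
  note ge = polydisc_norm_ge_real[of A a, OF A a_sym]
  have S: "\<bar>a 1 1 + a 2 2 + a 3 3 + 2 * a 1 2 + 2 * a 1 3 + 2 * a 2 3\<bar> \<le> ?S"
    "\<bar>a 1 1 + a 2 2 + a 3 3 + 2 * a 1 2 - 2 * a 1 3 - 2 * a 2 3\<bar> \<le> ?S"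
    "\<bar>a 1 1 + a 2 2 + a 3 3 - 2 * a 1 2 + 2 * a 1 3 - 2 * a 2 3\<bar> \<le> ?S"
    "\<bar>a 1 1 + a 2 2 + a 3 3 - 2 * a 1 2 - 2 * a 1 3 + 2 * a 2 3\<bar> \<le> ?S"
    using ge[of 1 1 1] ge[of 1 1 "-1"] ge[of 1 "-1" 1] ge[of "-1" 1 1] by simp_all
  then have mS: "\<bar>- a 1 1 + - a 2 2 + - a 3 3 + 2 * - a 1 2 + 2 * - a 1 3 + 2 * - a 2 3\<bar> \<le> ?S"
    "\<bar>- a 1 1 + - a 2 2 + - a 3 3 + 2 * - a 1 2 - 2 * - a 1 3 - 2 * - a 2 3\<bar> \<le> ?S"
    "\<bar>- a 1 1 + - a 2 2 + - a 3 3 - 2 * - a 1 2 + 2 * - a 1 3 - 2 * - a 2 3\<bar> \<le> ?S"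
    "\<bar>- a 1 1 + - a 2 2 + - a 3 3 - 2 * - a 1 2 - 2 * - a 1 3 + 2 * - a 2 3\<bar> \<le> ?S"
    unfolding abs_le_iff by simp_all
  show ?thesis
  proof (rule rho_quad_poly_le[OF A a_sym])
    fix x y z
    assume R: "x \<in> real_ell2" "y \<in> real_ell2" "z \<in> real_ell2"
      and N: "norm x \<le> 1" "norm y \<le> 1" "norm z \<le> 1"
    have n: "rinner x x \<le> 1" "rinner y y \<le> 1" "rinner z z \<le> 1"
      using R N by (simp_all add: rinner_self power_le_one)
    have gram2: "\<bar>2 * rinner v w\<bar> \<le> rinner v v + rinner w w"
      if "v \<in> real_ell2" "w \<in> real_ell2" for v w
      using gram_nonneg[OF that that(1), of 1 1 0] gram_nonneg[OF that that(1), of 1 "-1" 0]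
      unfolding abs_le_iff by simp
    note g2 = gram2[OF R(1,2)] gram2[OF R(1,3)] gram2[OF R(2,3)]
    have g3: "0 \<le> rinner x x + rinner y y + rinner z z + 2 * rinner x y + 2 * rinner x z + 2 * rinner y z"
      "0 \<le> rinner x x + rinner y y + rinner z z + 2 * rinner x y - 2 * rinner x z - 2 * rinner y z"
      "0 \<le> rinner x x + rinner y y + rinner z z - 2 * rinner x y + 2 * rinner x z - 2 * rinner y z"
      "0 \<le> rinner x x + rinner y y + rinner z z - 2 * rinner x y - 2 * rinner x z + 2 * rinner y z"
      using gram_nonneg[OF R, of 1 1 1] gram_nonneg[OF R, of 1 1 "-1"] gram_nonneg[OF R, of 1 "-1" 1]
        gram_nonneg[OF R, of "-1" 1 1] by simp_all
    show "\<bar>a 1 1 * rinner x x + a 2 2 * rinner y y + a 3 3 * rinner z z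
        + 2 * a 1 2 * rinner x y + 2 * a 1 3 * rinner x z + 2 * a 2 3 * rinner y z\<bar> \<le> 6 / 5 * ?S"
      using sign_form_le[OF a a a a a a n g2 g3 S] sign_form_le[OF ma ma ma ma ma ma n g2 g3 mS]
      unfolding abs_le_iff by (simp add: algebra_simps)
  qed simp
qed

text \<open>
  The sign vectors give \<open>\<bar>7 + 2 \<alpha>\<bar>\<close> and \<open>\<bar>3 - 2 \<alpha>\<bar>\<close>. With \<open>b = - \<alpha> > 0\<close>, completing the square in \<open>x\<^sub>1\<close>
  bounds the form by \<open>3 + 2 b + 1/b\<close>. This is at most \<open>6/5 (7 - 2 b)\<close> for \<open>b\<close> between \<open>5/22\<close> and 1,
  and at most \<open>6/5 (3 + 2 b)\<close> for \<open>b \<ge> 1\<close>, with equality at \<open>b = 1\<close>, where the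
  polynomial is the Varopoulos--Kaijser one up to the sign of a variable.
\<close>

lemma rho_B_mat: "rho (quad_poly (B_mat \<alpha>)) \<le> 6 / 5"
proof -
  define a :: "3 \<Rightarrow> 3 \<Rightarrow> real"
    where "a j k = (if j \<noteq> k \<and> j \<noteq> 1 \<and> k \<noteq> 1 then \<alpha> else 1)" for j k
  have A: "B_mat \<alpha> $ j $ k = complex_of_real (a j k)" for j k
    using exhaust_3[of j] exhaust_3[of k] by (auto simp: B_mat_def a_def vector_3)
  have a_sym: "a j k = a k j" for j k by (auto simp: a_def)
  let ?S = "polydisc_norm (quad_poly (B_mat \<alpha>))"
  have "\<bar>7 + 2 * \<alpha>\<bar> \<le> ?S" "\<bar>3 - 2 * \<alpha>\<bar> \<le> ?S"
    using polydisc_norm_ge_real[of _ a 1 1 1, OF A a_sym]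
      polydisc_norm_ge_real[of _ a 1 1 "-1", OF A a_sym] by (simp_all add: a_def)
  then have S1: "7 + 2 * \<alpha> \<le> ?S" and S2: "3 - 2 * \<alpha> \<le> ?S"
    by (auto dest: abs_le_D1)
  show ?thesis
  proof (rule rho_quad_poly_le[OF A a_sym])
    fix x y z
    assume R: "x \<in> real_ell2" "y \<in> real_ell2" "z \<in> real_ell2"
      and N: "norm x \<le> 1" "norm y \<le> 1" "norm z \<le> 1"
    define n1 n2 n3 u v w where "n1 = rinner x x" and "n2 = rinner y y" and "n3 = rinner z z"
      and "u = rinner x y" and "v = rinner x z" and "w = rinner y z"
    note defs = n1_def n2_def n3_def u_def v_def w_def
    let ?f = "n1 + n2 + n3 + 2 * u + 2 * v + 2 * (\<alpha> * w)"
    have n: "0 \<le> n1" "n1 \<le> 1" "n2 \<le> 1" "n3 \<le> 1"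
      using R N by (simp_all add: defs rinner_self power_le_one)
    have ip: "\<bar>rinner v w\<bar> \<le> 1" if "norm v \<le> 1" "norm w \<le> 1" for v w
      using abs_rinner_le[of v w] mult_mono[OF that] by simp
    have uvw: "\<bar>u\<bar> \<le> 1" "\<bar>v\<bar> \<le> 1" "\<bar>w\<bar> \<le> 1"
      unfolding defs using ip N by blast+
    have aw: "\<bar>\<alpha> * w\<bar> \<le> \<bar>\<alpha>\<bar>" "\<bar>(\<alpha> - 1) * w\<bar> \<le> \<bar>\<alpha> - 1\<bar>"
      using uvw(3) by (simp_all add: abs_mult mult_left_le)
    have lower: "- ?f \<le> 6 / 5 * ?S"
    proof -
      have "0 \<le> n1 + n2 + n3 + 2 * u + 2 * v + 2 * w"
        using gram_nonneg[OF R, of 1 1 1] by (simp add: defs)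
      then have "- ?f \<le> - 2 * ((\<alpha> - 1) * w)" by (simp add: algebra_simps)
      also have "\<dots> \<le> 2 * \<bar>\<alpha> - 1\<bar>" using abs_le_D2[OF aw(2)] by (simp add: algebra_simps)
      also have "\<dots> \<le> 6 / 5 * ?S" using S1 S2 by (cases "1 \<le> \<alpha>") simp_all
      finally show ?thesis .
    qed
    have crude: "?f \<le> 7 + 2 * \<bar>\<alpha>\<bar>"
      using n abs_le_D1[OF uvw(1)] abs_le_D1[OF uvw(2)] abs_le_D1[OF aw(1)] by simp
    have upper: "?f \<le> 6 / 5 * ?S"
    \<comment> \<open>Any threshold between \<open>-7/22\<close> (for the crude bound) and \<open>-5/22\<close> works.\<close>
    proof (cases "- 1/4 \<le> \<alpha>")
      case True
      then have "7 + 2 * \<bar>\<alpha>\<bar> \<le> 6 / 5 * ?S" using S1 True by (cases "0 \<le> \<alpha>") simp_all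
      with crude show ?thesis by (rule order_trans)
    next
      case False
      define b where "b = - \<alpha>"
      have b: "1/4 < b" "0 < b" using False by (simp_all add: b_def)
      have "0 \<le> n1 + b\<^sup>2 * (n2 + n3 + 2 * w) - 2 * b * (u + v)"
        using gram_nonneg[OF R, of 1 "-b" "-b"] by (simp add: defs power2_eq_square algebra_simps)
      then have "b * (2 * (u + v)) \<le> b * (n1 / b + b * (n2 + n3 + 2 * w))"
        using b by (simp add: power2_eq_square algebra_simps)
      then have "2 * (u + v) \<le> n1 / b + b * (n2 + n3 + 2 * w)"
        by (simp only: mult_le_cancel_left_pos[OF b(2)])
      then have "?f \<le> n1 + n1 / b + (1 + b) * (n2 + n3)"
        by (simp add: b_def algebra_simps)
      also have "\<dots> \<le> 1 + 1 / b + (1 + b) * 2"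
        using b n by (intro add_mono mult_left_mono divide_right_mono) auto
      also have "\<dots> \<le> 6 / 5 * ?S"
      proof (cases "b \<le> 1")
        case True
        have "(1 - b) * (22 * b - 5) \<ge> 0" using True b by simp
        then have "1 \<le> (27 / 5 - 22 / 5 * b) * b"
          by (simp add: algebra_simps)
        then have "1 / b \<le> 27 / 5 - 22 / 5 * b"
          by (simp only: pos_divide_le_eq[OF b(2)])
        then show ?thesis using S1 by (simp add: b_def)
      next
        case False
        then have "0 \<le> (b - 1) * (2 * b + 5)" by simp
        then have "1 \<le> (3 / 5 + 2 / 5 * b) * b"
          by (simp add: algebra_simps)
        then have "1 / b \<le> 3 / 5 + 2 / 5 * b"
          by (simp only: pos_divide_le_eq[OF b(2)])
        then show ?thesis using S2 by (simp add: b_def)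
      qed
      finally show ?thesis .
    qed
    show "\<bar>a 1 1 * rinner x x + a 2 2 * rinner y y + a 3 3 * rinner z z
        + 2 * a 1 2 * rinner x y + 2 * a 1 3 * rinner x z + 2 * a 2 3 * rinner y z\<bar> \<le> 6 / 5 * ?S"
      using abs_leI[OF upper lower] by (simp add: a_def defs[symmetric] mult.assoc)
  qed simp
qed

theorem mainTheorem4:
  shows "(\<forall>A :: complex^3^3. transpose A = A \<and> (\<forall>j k. A $ j $ k \<in> {1, -1})
            \<longrightarrow> rho (quad_poly A) \<le> rho p_VK)
       \<and> (\<forall>\<alpha> :: real. rho (quad_poly (B_mat \<alpha>)) \<le> rho p_VK)"
proof (intro conjI allI impI)
  fix A :: "complex^3^3"
  assume "transpose A = A \<and> (\<forall>j k. A $ j $ k \<in> {1, -1})"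
  then have "rho (quad_poly A) \<le> 6 / 5" by (intro rho_sign_matrix) auto
  then show "rho (quad_poly A) \<le> rho p_VK" using rho_VK_ge by (rule order_trans)
next
  fix \<alpha> :: real
  show "rho (quad_poly (B_mat \<alpha>)) \<le> rho p_VK" using rho_B_mat rho_VK_ge by (rule order_trans)
qed

end
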